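(* Let $G=G(V,E)$ be a simple graph with $|V|=n$ (identify $V$ with $[n]$). The Cover-Reversal random walk on the acyclic orientations of $G$ is a simple random walk, of period $2$, on the $1$-skeleton of the polytope $P_G$ (hence on a simple connected bipartite graph whose vertex set is the set of acyclic orientations of $G$), and its stationary distribution $\pi^{\mathrm{CR}}$ satisfies $\pi^{\mathrm{CR}}_O=c\cdot|\mathrm{Cov}(O)|$ for every acyclic orientation $O$ of $G$, where $c>0$ is a normalization constant independent of $O$.
   Context: An acyclic orientation $O$ of $G$ orients every edge with no directed cycles and is viewed as the poset $(V,\le_O)$ it generates, $(u,v)$ meaning $u<_O v$. $\mathrm{Cov}(O)$ is the set of directed edges of $O$ that are cover relations of $(V,\le_O)$. Cover-Reversal random walk: start from any acyclic orientation $O_0$; for $t\ge1$ choose $(u,v)\in\mathrm{Cov}(O_{t-1})$ uniformly at random and let $O_t$ be $O_{t-1}$ with the orientation of $\{u,v\}$ reversed to $(v,u)$. $P_G=\{x\in\mathbb{R}^{[n]}:\sum_i x_i=n+|E|,\ \sum_{i\in\sigma}x_i\ge|\sigma|+|E(G[\sigma])|\ \forall\sigma\subseteq[n]\}$; its vertices are exactly the points $(\mathrm{indeg}_O(i)+1)_{i\in[n]}$ for acyclic orientations $O$ of $G$ ($\mathrm{indeg}_O(i)$ = number of edges directed into $i$), giving the identification of vertices with acyclic orientations. A simple random walk on a graph moves at each step to a uniformly random neighbor. *)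

theory Defs
  imports "HOL-Analysis.Analysis" "HOL-Probability.Probability"
begin

section \<open>Simple graphs and random walks\<close>

text \<open>A graph is given by a vertex set \<open>V\<close> and a set \<open>E\<close> of edges, each edge being a
  two-element set of vertices.\<close>

definition simple_graph :: "'v set \<Rightarrow> 'v set set \<Rightarrow> bool" where
  "simple_graph V E \<longleftrightarrow> (\<forall>e\<in>E. \<exists>u\<in>V. \<exists>v\<in>V. u \<noteq> v \<and> e = {u, v})"

definition connected_graph :: "'v set \<Rightarrow> 'v set set \<Rightarrow> bool" where
  "connected_graph V E \<longleftrightarrow>
     V \<noteq> {} \<and> (\<forall>u\<in>V. \<forall>v\<in>V. (u, v) \<in> {(x, y). {x, y} \<in> E}\<^sup>*)"

definition bipartite_graph :: "'v set \<Rightarrow> 'v set set \<Rightarrow> bool" where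
  "bipartite_graph V E \<longleftrightarrow>
     (\<exists>A B. A \<union> B = V \<and> A \<inter> B = {} \<and> (\<forall>e\<in>E. \<exists>a\<in>A. \<exists>b\<in>B. e = {a, b}))"

definition neighbours :: "'v set set \<Rightarrow> 'v \<Rightarrow> 'v set" where
  "neighbours E x = {y. {x, y} \<in> E}"

text \<open>A time-homogeneous Markov chain is given by its transition kernel \<open>K\<close>. The
  nonemptiness and finiteness conditions below guard against the unspecified values of
  \<^const>\<open>pmf_of_set\<close>.\<close>

definition simple_random_walk :: "'v set \<Rightarrow> 'v set set \<Rightarrow> ('v \<Rightarrow> 'v pmf) \<Rightarrow> bool" where
  "simple_random_walk V E K \<longleftrightarrow>
     (\<forall>x\<in>V. neighbours E x \<noteq> {} \<and> finite (neighbours E x) \<and> K x = pmf_of_set (neighbours E x))"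

primrec dist_at_time :: "('v \<Rightarrow> 'v pmf) \<Rightarrow> nat \<Rightarrow> 'v \<Rightarrow> 'v pmf" where
  "dist_at_time K 0 x = return_pmf x"
| "dist_at_time K (Suc t) x = bind_pmf (dist_at_time K t x) K"

definition period :: "('v \<Rightarrow> 'v pmf) \<Rightarrow> 'v \<Rightarrow> nat" where
  "period K x = Gcd {t. t \<ge> 1 \<and> pmf (dist_at_time K t x) x > 0}"

definition stationary :: "'v set \<Rightarrow> ('v \<Rightarrow> 'v pmf) \<Rightarrow> 'v pmf \<Rightarrow> bool" where
  "stationary V K \<pi> \<longleftrightarrow> set_pmf \<pi> \<subseteq> V \<and> bind_pmf \<pi> K = \<pi>"


section \<open>Acyclic orientations and the Cover-Reversal walk\<close>

definition orientation :: "'v set set \<Rightarrow> ('v \<times> 'v) set \<Rightarrow> bool" where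
  "orientation E D \<longleftrightarrow>
     (\<forall>(u, v)\<in>D. {u, v} \<in> E) \<and>
     (\<forall>u v. {u, v} \<in> E \<longrightarrow> ((u, v) \<in> D) \<noteq> ((v, u) \<in> D))"

definition acyclic_orientations :: "'v set set \<Rightarrow> ('v \<times> 'v) set set" where
  "acyclic_orientations E = {D. orientation E D \<and> acyclic D}"

text \<open>For acyclic \<open>D\<close>, the strict order of the generated poset is \<open>D\<^sup>+\<close>.\<close>

definition cover_relations :: "('v \<times> 'v) set \<Rightarrow> ('v \<times> 'v) set" where
  "cover_relations r = {(u, v) \<in> r. \<nexists>w. (u, w) \<in> r \<and> (w, v) \<in> r}"

definition Cov :: "('v \<times> 'v) set \<Rightarrow> ('v \<times> 'v) set" where
  "Cov D = D \<inter> cover_relations (D\<^sup>+)"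

definition reverse_edge :: "('v \<times> 'v) set \<Rightarrow> 'v \<times> 'v \<Rightarrow> ('v \<times> 'v) set" where
  "reverse_edge D e = insert (snd e, fst e) (D - {e})"

definition cover_reversal :: "('v \<times> 'v) set \<Rightarrow> ('v \<times> 'v) set pmf" where
  "cover_reversal D = map_pmf (reverse_edge D) (pmf_of_set (Cov D))"


section \<open>The polytope and its 1-skeleton\<close>

text \<open>The vertex set of the graph is the finite type \<open>'n\<close>, so that \<open>n = CARD('n)\<close>.\<close>

definition graph_polytope :: "'n::finite set set \<Rightarrow> (real ^ 'n) set" where
  "graph_polytope E =
     {x. (\<Sum>i\<in>UNIV. x $ i) = real CARD('n) + real (card E) \<and>
         (\<forall>\<sigma>. (\<Sum>i\<in>\<sigma>. x $ i) \<ge> real (card \<sigma>) + real (card {e \<in> E. e \<subseteq> \<sigma>}))}"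

definition skeleton_vertices :: "'a::euclidean_space set \<Rightarrow> 'a set" where
  "skeleton_vertices P = {x. x extreme_point_of P}"

definition skeleton_edges :: "'a::euclidean_space set \<Rightarrow> 'a set set" where
  "skeleton_edges P =
     {{x, y} | x y. x extreme_point_of P \<and> y extreme_point_of P \<and> closed_segment x y edge_of P}"

definition indeg :: "('v \<times> 'v) set \<Rightarrow> 'v \<Rightarrow> nat" where
  "indeg D i = card {u. (u, i) \<in> D}"

definition orientation_point :: "('n \<times> 'n) set \<Rightarrow> real ^ 'n::finite" where
  "orientation_point D = (\<chi> i. real (indeg D i) + 1)"

text \<open>The edges of the 1-skeleton, transported to the acyclic orientations along
  \<^const>\<open>orientation_point\<close>.\<close>

definition orientation_skeleton_edges :: "'n::finite set set \<Rightarrow> ('n \<times> 'n) set set set" where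
  "orientation_skeleton_edges E =
     {{D, D'} | D D'. D \<in> acyclic_orientations E \<and> D' \<in> acyclic_orientations E \<and>
        {orientation_point D, orientation_point D'} \<in> skeleton_edges (graph_polytope E)}"

end

theory Submission
  imports Defs
begin

text \<open>For an orientation \<open>D\<close>, the point \<^term>\<open>orientation_point D\<close> exceeds the bound of \<open>\<sigma>\<close> in
  \<^term>\<open>graph_polytope E\<close> by the number of edges of \<open>D\<close> entering \<open>\<sigma>\<close>, so it is tight exactly
  on the down-closed sets. A linear functional \<open>c\<close> is therefore minimised at any acyclic
  orientation along which \<open>c\<close> decreases, and the polytope is the convex hull of the points of the
  acyclic orientations; the initial segments of a linear extension show that each of these is a
  vertex. If \<open>(u, v)\<close> is a cover relation, the sets that are down-closed both before and after
  reversing it cut out the segment joining the two points. Conversely, if acyclic orientations \<open>D\<close>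
  and \<open>D'\<close> span an edge, some cover relation of \<open>D\<close> is reversed in \<open>D'\<close>. Exchanging this edge between
  \<open>D\<close> and \<open>D'\<close> yields two points of the polytope with the same midpoint, so the cover reversal of
  \<open>D\<close> lies on the edge and is its other endpoint \<open>D'\<close>. The same choice of a cover relation gives
  connectedness, and agreement with a fixed orientation changes parity at each step. On a finite
  connected graph, a stationary distribution divided by the degree is harmonic, hence constant.\<close>

section \<open>Simple random walks\<close>

lemma neighbours_subset:
  assumes "simple_graph V E"
  shows "neighbours E x \<subseteq> V"
  using assms unfolding simple_graph_def neighbours_def by (fastforce simp: doubleton_eq_iff)

lemma neighbours_sym: "y \<in> neighbours E x \<longleftrightarrow> x \<in> neighbours E y"
  by (simp add: neighbours_def insert_commute)

text \<open>Adjacency is symmetric, so the states that can move to \<open>y\<close> are its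
  neighbours, each sending its mass divided by its own degree.\<close>

lemma pmf_bind_simple_random_walk:
  assumes V: "finite V" "simple_graph V E" and K: "simple_random_walk V E K"
    and \<pi>: "set_pmf \<pi> \<subseteq> V"
  shows "pmf (bind_pmf \<pi> K) y = (\<Sum>x\<in>neighbours E y. pmf \<pi> x / real (card (neighbours E x)))"
proof -
  have "pmf (bind_pmf \<pi> K) y = (\<Sum>x\<in>V. pmf (K x) y * pmf \<pi> x)"
    unfolding pmf_bind by (intro integral_measure_pmf_real) (use V \<pi> in auto)
  also have "\<dots> = (\<Sum>x\<in>V. if x \<in> neighbours E y then pmf \<pi> x / real (card (neighbours E x)) else 0)"
  proof (intro sum.cong refl)
    fix x assume "x \<in> V"
    then have *: "neighbours E x \<noteq> {}" "finite (neighbours E x)" "K x = pmf_of_set (neighbours E x)"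
      using K by (auto simp: simple_random_walk_def)
    show "pmf (K x) y * pmf \<pi> x =
        (if x \<in> neighbours E y then pmf \<pi> x / real (card (neighbours E x)) else 0)"
      using * neighbours_sym[of x E y] by (simp add: indicator_def)
  qed
  also have "\<dots> = (\<Sum>x\<in>neighbours E y. pmf \<pi> x / real (card (neighbours E x)))"
    using V neighbours_subset[OF V(2), of y] by (simp add: sum.If_cases Int_absorb1)
  finally show ?thesis .
qed

text \<open>A harmonic function attains its maximum on a set closed under passing to neighbours.\<close>

lemma harmonic_imp_constant:
  fixes f :: "'v \<Rightarrow> real"
  assumes V: "finite V" "simple_graph V E" "connected_graph V E"
    and harmonic: "\<And>y. y \<in> V \<Longrightarrow> (\<Sum>x\<in>neighbours E y. f x) = real (card (neighbours E y)) * f y"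
    and "x \<in> V" "y \<in> V"
  shows "f x = f y"
proof -
  have "V \<noteq> {}" using \<open>x \<in> V\<close> by auto
  define M where "M = Max (f ` V)"
  have le: "f z \<le> M" if "z \<in> V" for z
    using V that by (simp add: M_def)
  obtain m where m: "m \<in> V" "f m = M"
    using Max_in[of "f ` V"] V(1) \<open>V \<noteq> {}\<close> unfolding M_def by fastforce
  have max_step: "f b = M" if "f a = M" "a \<in> V" "b \<in> neighbours E a" for a b
  proof -
    have fin: "finite (neighbours E a)"
      using neighbours_subset[OF V(2)] V(1) finite_subset by blast
    \<comment> \<open>Harmonicity at a maximum point makes these nonnegative gaps sum to zero, so
      each of them vanishes.\<close>
    have "(\<Sum>x\<in>neighbours E a. M - f x) = 0"
      using harmonic[OF \<open>a \<in> V\<close>] that by (simp add: sum_subtractf)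
    then have "\<forall>x\<in>neighbours E a. M - f x = 0"
      using fin le neighbours_subset[OF V(2), of a]
      by (subst (asm) sum_nonneg_eq_0_iff) auto
    then show ?thesis using that by auto
  qed
  have "f z = M" if "z \<in> V" for z
  proof -
    have "(m, z) \<in> {(x, y). {x, y} \<in> E}\<^sup>*"
      using V(3) m(1) that by (auto simp: connected_graph_def)
    then have "z \<in> V \<and> f z = M"
    proof induction
      case base then show ?case using m by simp
    next
      case (step a b)
      then have "b \<in> neighbours E a" by (simp add: neighbours_def)
      then show ?case using step.IH max_step neighbours_subset[OF V(2), of a] by blast
    qed
    then show ?thesis ..
  qed
  then show ?thesis using assms by simp
qed

text \<open>With mass \<open>c\<close> times the degree, every state sends exactly \<open>c\<close>
  along each of its edges, so the flow balances; \<open>c\<close> normalises the total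
  degree.\<close>

lemma stationary_simple_random_walk:
  assumes V: "finite V" "simple_graph V E" "connected_graph V E"
    and K: "simple_random_walk V E K"
  obtains \<pi> c where "stationary V K \<pi>" "c > 0"
    "\<And>x. x \<in> V \<Longrightarrow> pmf \<pi> x = c * real (card (neighbours E x))"
    "\<And>\<pi>'. stationary V K \<pi>' \<Longrightarrow> \<pi>' = \<pi>"
proof -
  have ne: "V \<noteq> {}" using V(3) by (simp add: connected_graph_def)
  let ?d = "\<lambda>x. real (card (neighbours E x))"
  have d: "?d x > 0" if "x \<in> V" for x
    using K that by (simp add: simple_random_walk_def card_gt_0_iff)
  define c where "c = 1 / (\<Sum>x\<in>V. ?d x)"
  have "(\<Sum>x\<in>V. ?d x) > 0" using V(1) ne d by (intro sum_pos) auto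
  then have c: "c > 0" "(\<Sum>x\<in>V. c * ?d x) = 1"
    unfolding sum_distrib_left[symmetric] by (simp_all add: c_def)
  define w where "w x = (if x \<in> V then c * ?d x else 0)" for x
  have w0: "w x \<ge> 0" for x using c by (simp add: w_def)
  have "(\<integral>\<^sup>+x. ennreal (w x) \<partial>count_space UNIV) = (\<Sum>x\<in>V. ennreal (w x))"
    by (rule nn_integral_count_space'[OF V(1)]) (auto simp: w_def)
  also have "\<dots> = ennreal (\<Sum>x\<in>V. w x)" using w0 by simp
  also have "\<dots> = 1" using c(2) by (simp add: w_def)
  finally have w1: "(\<integral>\<^sup>+x. ennreal (w x) \<partial>count_space UNIV) = 1" .
  define \<pi> where "\<pi> = embed_pmf w"
  have \<pi>: "pmf \<pi> x = w x" for x
    unfolding \<pi>_def using w0 w1 by (rule pmf_embed_pmf)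
  have set_\<pi>: "set_pmf \<pi> \<subseteq> V"
    by (auto simp: set_pmf_iff \<pi> w_def split: if_splits)
  have "bind_pmf \<pi> K = \<pi>"
  proof (rule pmf_eqI)
    fix y
    have "pmf (bind_pmf \<pi> K) y = (\<Sum>x\<in>neighbours E y. c)"
      unfolding pmf_bind_simple_random_walk[OF V(1,2) K set_\<pi>]
      using neighbours_subset[OF V(2), of y] d by (intro sum.cong) (force simp: \<pi> w_def)+
    also have "\<dots> = c * ?d y" by simp
    also have "\<dots> = pmf \<pi> y"
    proof (cases "y \<in> V")
      \<comment> \<open>The equality of pmfs is tested at every point of the type; a point outside
        \<open>V\<close> has no neighbours, so both sides are zero.\<close>
      case False
      then have "neighbours E y = {}"
        using neighbours_subset[OF V(2)] neighbours_sym[of _ E y] by blast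
      then show ?thesis using False by (simp add: \<pi> w_def)
    qed (simp add: \<pi> w_def)
    finally show "pmf (bind_pmf \<pi> K) y = pmf \<pi> y" .
  qed
  then have stat: "stationary V K \<pi>" using set_\<pi> by (simp add: stationary_def)
  have uniq: "\<pi>' = \<pi>" if "stationary V K \<pi>'" for \<pi>'
  proof -
    have set': "set_pmf \<pi>' \<subseteq> V" and bind': "bind_pmf \<pi>' K = \<pi>'"
      using that by (auto simp: stationary_def)
    \<comment> \<open>In terms of this quotient, the balance equation at \<open>y\<close> says that
      \<open>f\<close> is harmonic there.\<close>
    define f where "f x = pmf \<pi>' x / ?d x" for x
    have "(\<Sum>x\<in>neighbours E y. f x) = ?d y * f y" if "y \<in> V" for y
      using pmf_bind_simple_random_walk[OF V(1,2) K set', of y] d[OF that]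
      unfolding f_def bind' by simp
    then have const: "f x = f y" if "x \<in> V" "y \<in> V" for x y
      using harmonic_imp_constant[OF V, of f x y] that by blast
    obtain o' where o': "o' \<in> V" using ne by auto
    have eq: "pmf \<pi>' x = f o' * ?d x" if "x \<in> V" for x
      using const[OF that o'] d[OF that] by (simp add: f_def field_simps)
    have "(\<Sum>x\<in>V. pmf \<pi>' x) = 1" by (rule sum_pmf_eq_1[OF V(1) set'])
    then have "f o' * (\<Sum>x\<in>V. ?d x) = 1"
      by (simp add: eq sum_distrib_left)
    then have "f o' = c" using \<open>(\<Sum>x\<in>V. ?d x) > 0\<close> by (simp add: c_def field_simps)
    then have "pmf \<pi>' x = pmf \<pi> x" for x
      using eq set' by (cases "x \<in> V") (auto simp: \<pi> w_def set_pmf_iff)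
    then show ?thesis by (rule pmf_eqI)
  qed
  show thesis
    by (rule that[OF stat c(1) _ uniq]) (simp_all add: \<pi> w_def)
qed

text \<open>Each step changes sides, so all return times are even; going along an edge and back
  gives the return time 2, so the gcd is exactly 2.\<close>

lemma period_bipartite_simple_random_walk:
  assumes V: "simple_graph V E" "bipartite_graph V E"
    and K: "simple_random_walk V E K" and x: "x \<in> V"
  shows "period K x = 2"
proof -
  obtain A B where AB: "A \<union> B = V" "A \<inter> B = {}" "\<forall>e\<in>E. \<exists>a\<in>A. \<exists>b\<in>B. e = {a, b}"
    using V(2) unfolding bipartite_graph_def by (elim exE conjE) (rule that)
  have setK: "set_pmf (K y) = neighbours E y" if "y \<in> V" for y
    using K that by (simp add: simple_random_walk_def)
  have flip: "z \<in> V \<and> (z \<in> A \<longleftrightarrow> y \<notin> A)" if "y \<in> V" "z \<in> set_pmf (K y)" for y z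
  proof -
    have "{y, z} \<in> E" using that setK by (simp add: neighbours_def)
    then obtain a b where "a \<in> A" "b \<in> B" "{y, z} = {a, b}" using AB(3)[rule_format] by metis
    then show ?thesis using AB(1,2) by (auto simp: doubleton_eq_iff)
  qed
  have parity: "z \<in> V \<and> (z \<in> A \<longleftrightarrow> (x \<in> A \<longleftrightarrow> even t))" if "z \<in> set_pmf (dist_at_time K t x)" for t z
    using that
  proof (induction t arbitrary: z)
    case 0 then show ?case using x by simp
  next
    case (Suc t)
    then obtain y where y: "y \<in> set_pmf (dist_at_time K t x)" "z \<in> set_pmf (K y)" by auto
    show ?case using Suc.IH[OF y(1)] flip[of y z] y(2) by auto
  qed
  have even: "even t" if "pmf (dist_at_time K t x) x > 0" for t
    using parity[of x t] that by (auto simp: set_pmf_iff)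
  obtain y where y: "y \<in> neighbours E x"
    using K x by (auto simp: simple_random_walk_def)
  then have "y \<in> V" "x \<in> neighbours E y"
    using neighbours_subset[OF V(1)] neighbours_sym[of x E y] by auto
  then have "x \<in> set_pmf (dist_at_time K 2 x)"
    using y x setK by (auto simp: numeral_2_eq_2 bind_return_pmf intro!: bexI[of _ y])
  then have two: "2 \<in> {t. t \<ge> 1 \<and> pmf (dist_at_time K t x) x > 0}"
    by (simp add: pmf_positive)
  show ?thesis unfolding period_def
  proof (rule dvd_antisym)
    show "Gcd {t. t \<ge> 1 \<and> pmf (dist_at_time K t x) x > 0} dvd 2" using two by (rule Gcd_dvd)
    show "2 dvd Gcd {t. t \<ge> 1 \<and> pmf (dist_at_time K t x) x > 0}"
      using even by (intro Gcd_greatest) auto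
  qed
qed

section \<open>Acyclic orientations and cover relations\<close>

lemma orientation_edge: "orientation E D \<Longrightarrow> (u, v) \<in> D \<Longrightarrow> {u, v} \<in> E"
  by (auto simp: orientation_def)

lemma orientation_asym: "orientation E D \<Longrightarrow> (u, v) \<in> D \<Longrightarrow> (v, u) \<notin> D"
  by (auto simp: orientation_def)

lemma orientation_irrefl: "orientation E D \<Longrightarrow> (u, u) \<notin> D"
  using orientation_asym by metis

lemma orientation_total: "orientation E D \<Longrightarrow> {u, v} \<in> E \<Longrightarrow> (u, v) \<in> D \<or> (v, u) \<in> D"
  by (auto simp: orientation_def)

lemma orientation_subset_imp_eq:
  assumes "orientation E D" "orientation E D'" "D \<subseteq> D'"
  shows "D = D'"
proof
  show "D' \<subseteq> D"
  proof clarify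
    fix a b assume "(a, b) \<in> D'"
    then show "(a, b) \<in> D"
      using assms orientation_edge[of E D' a b] orientation_total[of E D a b]
        orientation_asym[of E D' a b] by blast
  qed
qed (fact assms)

lemma exists_acyclic_orientation_antimono:
  fixes c :: "'n::finite \<Rightarrow> real"
  assumes "simple_graph UNIV E"
  obtains D where "D \<in> acyclic_orientations E" "\<And>a b. (a, b) \<in> D \<Longrightarrow> c a \<ge> c b"
proof -
  obtain g :: "'n \<Rightarrow> nat" where g: "inj g"
    using finite_imp_inj_to_nat_seg[of "UNIV :: 'n set"] by auto
  \<comment> \<open>Edges point towards smaller \<open>c\<close>; the injective numbering
    \<open>g\<close> breaks ties, which makes \<open>r\<close> a strict order and the orientation
    acyclic.\<close>
  define r where "r = {(a, b). c a > c b \<or> (c a = c b \<and> g a < g b)}"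
  define D where "D = {(a, b) \<in> r. {a, b} \<in> E}"
  have "trans r" "irrefl r"
    by (auto simp: r_def trans_def irrefl_def)
  then have "acyclic r" by (simp add: acyclic_irrefl trancl_id)
  then have "acyclic D" by (rule acyclic_subset) (auto simp: D_def)
  moreover have "orientation E D"
    unfolding orientation_def
  proof (intro conjI allI impI)
    fix u v assume "{u, v} \<in> E"
    moreover from this have "u \<noteq> v"
      using assms by (auto simp: simple_graph_def)
    then have "g u \<noteq> g v" using g by (auto dest: injD)
    ultimately show "((u, v) \<in> D) \<noteq> ((v, u) \<in> D)"
      by (auto simp: D_def r_def insert_commute)
  qed (auto simp: D_def)
  ultimately show thesis
    by (intro that[of D]) (auto simp: acyclic_orientations_def D_def r_def)
qed

lemma acyclic_linear_extension:
  fixes r :: "('a::finite \<times> 'a) set"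
  assumes "acyclic r"
  obtains g :: "'a \<Rightarrow> nat" where "inj g" "\<And>a b. (a, b) \<in> r \<Longrightarrow> g a < g b"
proof -
  have wf: "wf r" using assms by (intro finite_acyclic_wf) auto
  have "\<exists>g::'a \<Rightarrow> nat. inj_on g A \<and> (\<forall>a\<in>A. \<forall>b\<in>A. (a, b) \<in> r \<longrightarrow> g a < g b)" for A
  proof (induction "card A" arbitrary: A)
    case 0
    then show ?case by auto
  next
    case (Suc k)
    then obtain m where m: "m \<in> A" "\<And>y. (y, m) \<in> r \<Longrightarrow> y \<notin> A"
      using wf by (metis card.empty ex_in_conv nat.distinct(1) wfE_min)
    have "k = card (A - {m})" using Suc.hyps(2) m by simp
    from Suc.hyps(1)[OF this] obtain g :: "'a \<Rightarrow> nat" where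
      g: "inj_on g (A - {m})" "\<forall>a\<in>A - {m}. \<forall>b\<in>A - {m}. (a, b) \<in> r \<longrightarrow> g a < g b" by blast
    \<comment> \<open>The minimal element \<open>m\<close> is listed first and all others move up by
      one.\<close>
    let ?g = "\<lambda>a. if a = m then 0 else Suc (g a)"
    have "inj_on ?g A" using g(1) by (auto simp: inj_on_def)
    moreover have "\<forall>a\<in>A. \<forall>b\<in>A. (a, b) \<in> r \<longrightarrow> ?g a < ?g b" using g(2) m(2) by auto
    ultimately show ?case by blast
  qed
  from this[of UNIV] that show thesis by auto
qed

lemma Cov_subset: "Cov D \<subseteq> D"
  by (auto simp: Cov_def)

text \<open>By induction on the gap in a linear extension: a related pair with something strictly
  between splits into two pairs with smaller gaps, and any other pair is a cover relation that is
  itself an edge.\<close>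

lemma trancl_Cov:
  fixes D :: "('a::finite \<times> 'a) set"
  assumes "acyclic D"
  shows "(Cov D)\<^sup>+ = D\<^sup>+"
proof
  show "(Cov D)\<^sup>+ \<subseteq> D\<^sup>+" by (rule trancl_mono_subset[OF Cov_subset])
next
  obtain g :: "'a \<Rightarrow> nat" where g: "\<And>a b. (a, b) \<in> D \<Longrightarrow> g a < g b"
    using acyclic_linear_extension[OF assms] by blast
  have g': "g a < g b" if "(a, b) \<in> D\<^sup>+" for a b
    using that by induction (auto dest: g)
  have "(x, y) \<in> (Cov D)\<^sup>+" if "(x, y) \<in> D\<^sup>+" for x y
    using that
  proof (induction "g y - g x" arbitrary: x y rule: less_induct)
    case less
    show ?case
    proof (cases "\<exists>w. (x, w) \<in> D\<^sup>+ \<and> (w, y) \<in> D\<^sup>+")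
      case True
      then obtain w where w: "(x, w) \<in> D\<^sup>+" "(w, y) \<in> D\<^sup>+" by blast
      then have "g x < g w" "g w < g y" using g' by auto
      then have "(x, w) \<in> (Cov D)\<^sup>+" "(w, y) \<in> (Cov D)\<^sup>+"
        using w by (auto intro!: less.hyps)
      then show ?thesis by (rule trancl_trans)
    next
      case False
      moreover from this less.prems have "(x, y) \<in> D"
        by (metis tranclE r_into_trancl)
      ultimately show ?thesis
        using less.prems by (auto simp: Cov_def cover_relations_def)
    qed
  qed
  then show "D\<^sup>+ \<subseteq> (Cov D)\<^sup>+" by auto
qed

text \<open>If \<open>D'\<close> contained every cover relation of \<open>D\<close>, its order would
  extend that of \<open>D\<close>; acyclicity would then force \<open>D'\<close> to orient every
  edge as \<open>D\<close> does.\<close>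

lemma exists_Cov_reversed:
  fixes D D' :: "('n::finite \<times> 'n) set"
  assumes D: "D \<in> acyclic_orientations E" "D' \<in> acyclic_orientations E" and "D \<noteq> D'"
  obtains a b where "(a, b) \<in> Cov D" "(b, a) \<in> D'"
proof -
  have o: "orientation E D" "orientation E D'" "acyclic D" "acyclic D'"
    using D by (auto simp: acyclic_orientations_def)
  have "\<not> Cov D \<subseteq> D'"
  proof
    assume "Cov D \<subseteq> D'"
    then have "D\<^sup>+ \<subseteq> D'\<^sup>+" using trancl_Cov[OF o(3)] trancl_mono_subset by metis
    have "D \<subseteq> D'"
    proof clarify
      fix a b assume ab: "(a, b) \<in> D"
      then have "(a, b) \<in> D'\<^sup>+" using \<open>D\<^sup>+ \<subseteq> D'\<^sup>+\<close> by auto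
      then have "(b, a) \<notin> D'" using o(4) by (metis acyclic_def trancl_into_trancl)
      then show "(a, b) \<in> D'"
        using orientation_total[OF o(2)] orientation_edge[OF o(1) ab] by blast
    qed
    then show False using orientation_subset_imp_eq[OF o(1,2)] \<open>D \<noteq> D'\<close> by blast
  qed
  then obtain a b where ab: "(a, b) \<in> Cov D" "(a, b) \<notin> D'" by auto
  then have "{a, b} \<in> E" using Cov_subset orientation_edge[OF o(1)] by blast
  then have "(b, a) \<in> D'" using ab orientation_total[OF o(2)] by blast
  then show thesis using ab that by blast
qed

text \<open>Listing the elements below \<open>v\<close> other than \<open>u\<close> first, then \<open>u\<close> and \<open>v\<close> on one level,
  then everything else, is compatible with \<open>D\<close> because nothing lies strictly between
  \<open>u\<close> and \<open>v\<close>.\<close>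

lemma Cov_contraction:
  fixes D :: "('n::finite \<times> 'n) set"
  assumes D: "acyclic D" and uv: "(u, v) \<in> Cov D"
  obtains h :: "'n \<Rightarrow> nat" where "\<And>a b. (a, b) \<in> D \<Longrightarrow> h a \<le> h b"
    "\<And>a b. h a = h b \<longleftrightarrow> a = b \<or> {a, b} = {u, v}"
proof -
  obtain g :: "'n \<Rightarrow> nat" where g: "inj g" "\<And>a b. (a, b) \<in> D \<Longrightarrow> g a < g b"
    using acyclic_linear_extension[OF D] by blast
  have uvD: "(u, v) \<in> D" and cov: "\<And>w. (u, w) \<in> D\<^sup>+ \<Longrightarrow> (w, v) \<notin> D\<^sup>+"
    using uv by (auto simp: Cov_def cover_relations_def)
  have "u \<noteq> v" using g(2)[OF uvD] by auto
  define S where "S = {w. (w, v) \<in> D\<^sup>+ \<and> w \<noteq> u}"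
  have S: "a \<in> S" if "(a, b) \<in> D" "b \<in> S" for a b
  proof -
    have "(a, v) \<in> D\<^sup>+" using that by (auto simp: S_def)
    moreover have "a \<noteq> u" using that cov[of b] by (auto simp: S_def)
    ultimately show ?thesis by (simp add: S_def)
  qed
  have Sv: "a \<in> S \<or> a = u" if "(a, v) \<in> D" for a
    using that by (auto simp: S_def)
  have Su: "a \<in> S" if "(a, u) \<in> D" for a
    using that uvD g(2)[OF that] by (auto simp: S_def)
  have nS: "u \<notin> S" "v \<notin> S"
    using D by (auto simp: S_def acyclic_def)
  \<comment> \<open>\<open>N\<close> exceeds all values of \<open>g\<close>, so the common level of
    \<open>u\<close> and \<open>v\<close> lies above all of \<open>S\<close>, and the remaining
    elements, shifted by \<open>Suc N\<close>, lie above that level.\<close>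
  define N where "N = Suc (Max (range g))"
  have N: "g a < N" for a by (simp add: N_def less_Suc_eq_le)
  define h where "h a = (if a \<in> S then g a else if a = u \<or> a = v then N else Suc (N + g a))" for a
  show thesis
  proof (rule that[of h])
    fix a b assume ab: "(a, b) \<in> D"
    show "h a \<le> h b"
    proof (cases "b \<in> S \<or> b = u \<or> b = v")
      case True
      then show ?thesis
        using S[OF ab] ab Sv Su nS g(2)[OF ab] N[of a] by (auto simp: h_def)
    next
      case False
      then show ?thesis using N[of a] g(2)[OF ab] by (auto simp: h_def)
    qed
  next
    fix a b
    show "h a = h b \<longleftrightarrow> a = b \<or> {a, b} = {u, v}"
      using nS N[of a] N[of b] \<open>u \<noteq> v\<close> inj_eq[OF g(1), of a b]
      by (auto simp: h_def doubleton_eq_iff)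
  qed
qed

section \<open>Reversal of a cover relation\<close>

lemma orientation_reverse_edge:
  assumes "orientation E D" "(u, v) \<in> D"
  shows "orientation E (reverse_edge D (u, v))"
  unfolding orientation_def
proof (intro conjI allI impI)
  show "\<forall>(a, b)\<in>reverse_edge D (u, v). {a, b} \<in> E"
    using orientation_edge[OF assms(1)] assms(2) by (auto simp: reverse_edge_def insert_commute)
next
  fix a b assume "{a, b} \<in> E"
  then show "((a, b) \<in> reverse_edge D (u, v)) \<noteq> ((b, a) \<in> reverse_edge D (u, v))"
    using orientation_total[OF assms(1), of a b] orientation_asym[OF assms(1)]
      orientation_irrefl[OF assms(1)] assms(2) by (auto simp: reverse_edge_def)
qed

lemma acyclic_reverse_Cov:
  fixes D :: "('n::finite \<times> 'n) set"
  assumes "acyclic D" "(u, v) \<in> Cov D"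
  shows "acyclic (reverse_edge D (u, v))"
proof -
  obtain h :: "'n \<Rightarrow> nat" where h: "\<And>a b. (a, b) \<in> D \<Longrightarrow> h a \<le> h b"
    "\<And>a b. h a = h b \<longleftrightarrow> a = b \<or> {a, b} = {u, v}"
    using Cov_contraction[OF assms] by blast
  have uv: "(u, v) \<in> D" using assms(2) Cov_subset by blast
  have irr: "(a, a) \<notin> D" for a using assms(1) by (auto simp: acyclic_def)
  have vu: "(v, u) \<notin> D" using uv assms(1) by (metis acyclic_def r_into_trancl trancl_into_trancl)
  \<comment> \<open>Doubling leaves room to put \<open>v\<close> just below \<open>u\<close> on
    their common level without disturbing the order between different levels.\<close>
  define k where "k i = 2 * h i + (if i = u then 1 else 0)" for i
  have "k a < k b" if "(a, b) \<in> reverse_edge D (u, v)" for a b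
  proof (cases "(a, b) = (v, u)")
    case True
    then show ?thesis using h(2)[of u v] irr uv by (auto simp: k_def)
  next
    case False
    then have ab: "(a, b) \<in> D" "(a, b) \<noteq> (u, v)" using that by (auto simp: reverse_edge_def)
    then have "h a \<noteq> h b"
      using h(2)[of a b] irr vu by (auto simp: doubleton_eq_iff)
    then have "h a < h b" using h(1)[OF ab(1)] by simp
    then show ?thesis by (auto simp: k_def)
  qed
  then show ?thesis by (intro wf_acyclic wf_subset[OF wf_measure[of k]]) auto
qed

lemma acyclic_orientations_reverse_Cov:
  fixes D :: "('n::finite \<times> 'n) set"
  assumes "D \<in> acyclic_orientations E" "(u, v) \<in> Cov D"
  shows "reverse_edge D (u, v) \<in> acyclic_orientations E"
  using assms orientation_reverse_edge[of E D u v] acyclic_reverse_Cov[of D u v] Cov_subset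
  by (auto simp: acyclic_orientations_def)

text \<open>The reversed edge can be recovered as the only element of \<open>D\<close> missing from
  the result. This later equates the degree of \<open>D\<close> with the number of its cover
  relations.\<close>

lemma inj_on_reverse_edge:
  assumes "orientation E D"
  shows "inj_on (reverse_edge D) D"
proof (rule inj_onI, clarify)
  fix a b a' b' assume *: "(a, b) \<in> D" "(a', b') \<in> D" "reverse_edge D (a, b) = reverse_edge D (a', b')"
  then have "(a, b) \<notin> reverse_edge D (a', b')"
    using orientation_irrefl[OF assms, of a] unfolding *(3)[symmetric]
    by (auto simp: reverse_edge_def)
  then show "a = a' \<and> b = b'" using *(1) by (simp add: reverse_edge_def)
qed

section \<open>Vertices of the polytope\<close>

definition polytope_bound :: "'n::finite set set \<Rightarrow> 'n set \<Rightarrow> real" where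
  "polytope_bound E \<sigma> = real (card \<sigma>) + real (card {e \<in> E. e \<subseteq> \<sigma>})"

definition downsets :: "('v \<times> 'v) set \<Rightarrow> 'v set set" where
  "downsets D = {\<sigma>. \<forall>(a, b)\<in>D. b \<in> \<sigma> \<longrightarrow> a \<in> \<sigma>}"

lemma graph_polytope_iff:
  "x \<in> graph_polytope E \<longleftrightarrow>
     (\<Sum>i\<in>UNIV. x $ i) = polytope_bound E UNIV \<and> (\<forall>\<sigma>. (\<Sum>i\<in>\<sigma>. x $ i) \<ge> polytope_bound E \<sigma>)"
  by (simp add: graph_polytope_def polytope_bound_def)

text \<open>The indegrees over \<open>\<sigma>\<close> count the edges with head in
  \<open>\<sigma>\<close>. Those whose tail is also inside correspond, on forgetting directions, to
  the edges of the induced subgraph; the rest are the excess.\<close>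

lemma sum_orientation_point:
  fixes D :: "('n::finite \<times> 'n) set"
  assumes E: "simple_graph UNIV E" and D: "orientation E D"
  shows "(\<Sum>i\<in>\<sigma>. orientation_point D $ i) =
    polytope_bound E \<sigma> + real (card {(a, b) \<in> D. a \<notin> \<sigma> \<and> b \<in> \<sigma>})"
proof -
  let ?in = "{(a, b) \<in> D. a \<in> \<sigma> \<and> b \<in> \<sigma>}" and ?enter = "{(a, b) \<in> D. a \<notin> \<sigma> \<and> b \<in> \<sigma>}"
  have "(\<Sum>i\<in>\<sigma>. indeg D i) = card (SIGMA i:\<sigma>. {u. (u, i) \<in> D})"
    by (simp add: indeg_def)
  also have "\<dots> = card (prod.swap ` (SIGMA i:\<sigma>. {u. (u, i) \<in> D}))"
    by (simp add: card_image)
  also have "prod.swap ` (SIGMA i:\<sigma>. {u. (u, i) \<in> D}) = ?in \<union> ?enter"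
    by (force simp: image_iff)
  also have "card \<dots> = card ?in + card ?enter"
    by (rule card_Un_disjoint) auto
  also have "card ?in = card {e \<in> E. e \<subseteq> \<sigma>}"
  proof (rule bij_betw_same_card[of "\<lambda>(a, b). {a, b}"], unfold bij_betw_def, intro conjI)
    show "inj_on (\<lambda>(a, b). {a, b}) ?in"
      using orientation_asym[OF D] by (auto simp: inj_on_def doubleton_eq_iff)
    show "(\<lambda>(a, b). {a, b}) ` ?in = {e \<in> E. e \<subseteq> \<sigma>}"
    proof (intro set_eqI iffI)
      fix e assume "e \<in> {e \<in> E. e \<subseteq> \<sigma>}"
      then obtain a b where ab: "e = {a, b}" "{a, b} \<in> E" "a \<in> \<sigma>" "b \<in> \<sigma>"
        using E unfolding simple_graph_def by fastforce
      then show "e \<in> (\<lambda>(a, b). {a, b}) ` ?in"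
        using orientation_total[OF D ab(2)] by (auto simp: image_iff insert_commute)
    qed (use orientation_edge[OF D] in auto)
  qed
  finally show ?thesis
    by (simp add: orientation_point_def polytope_bound_def sum.distrib flip: of_nat_sum)
qed

lemma orientation_point_in_polytope:
  fixes E :: "'n::finite set set"
  assumes "simple_graph UNIV E" "orientation E D"
  shows "orientation_point D \<in> graph_polytope E"
  unfolding graph_polytope_iff by (simp add: sum_orientation_point[OF assms])

lemma sum_orientation_point_downset:
  fixes E :: "'n::finite set set"
  assumes "simple_graph UNIV E" "orientation E D" "\<sigma> \<in> downsets D"
  shows "(\<Sum>i\<in>\<sigma>. orientation_point D $ i) = polytope_bound E \<sigma>"
proof -
  have "{(a, b) \<in> D. a \<notin> \<sigma> \<and> b \<in> \<sigma>} = {}" using assms(3) by (auto simp: downsets_def)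
  then show ?thesis by (simp only: sum_orientation_point[OF assms(1,2)]) simp
qed

lemma convex_graph_polytope: "convex (graph_polytope E)"
  unfolding convex_alt
proof (intro ballI allI impI)
  fix x y and u :: real
  assume *: "x \<in> graph_polytope E" "y \<in> graph_polytope E" "0 \<le> u \<and> u \<le> 1"
  have sum: "(\<Sum>i\<in>\<sigma>. ((1 - u) *\<^sub>R x + u *\<^sub>R y) $ i) = (1 - u) * (\<Sum>i\<in>\<sigma>. x $ i) + u * (\<Sum>i\<in>\<sigma>. y $ i)" for \<sigma>
    by (simp add: sum.distrib sum_distrib_left)
  have "(1 - u) * polytope_bound E \<sigma> + u * polytope_bound E \<sigma>
      \<le> (1 - u) * (\<Sum>i\<in>\<sigma>. x $ i) + u * (\<Sum>i\<in>\<sigma>. y $ i)" for \<sigma>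
    using * by (intro add_mono mult_left_mono) (auto simp: graph_polytope_iff)
  then show "(1 - u) *\<^sub>R x + u *\<^sub>R y \<in> graph_polytope E"
    unfolding graph_polytope_iff sum using * by (simp add: graph_polytope_iff algebra_simps)
qed

text \<open>Each tight inequality cuts out a face by a supporting hyperplane whose normal is the
  indicator vector of \<open>\<sigma>\<close>, and intersections of faces are faces.\<close>

lemma tight_face_of_graph_polytope:
  "{x \<in> graph_polytope E. \<forall>\<sigma>\<in>T. (\<Sum>i\<in>\<sigma>. x $ i) = polytope_bound E \<sigma>} face_of graph_polytope E"
  (is "?F face_of ?P")
proof -
  have "?F = ?P \<inter> \<Inter> ((\<lambda>\<sigma>. ?P \<inter> {x. (\<chi> i. if i \<in> \<sigma> then 1 else 0) \<bullet> x = polytope_bound E \<sigma>}) ` T)"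
    by (auto simp: inner_vec_def if_distrib[of "\<lambda>c. c * _"] sum.If_cases cong: if_cong)
  \<comment> \<open>Including the polytope itself keeps the family nonempty when \<open>T\<close> is
    empty, as \<open>face_of_Inter\<close> requires.\<close>
  also have "\<dots> = \<Inter> (insert ?P ((\<lambda>\<sigma>. ?P \<inter> {x. (\<chi> i. if i \<in> \<sigma> then 1 else 0) \<bullet> x = polytope_bound E \<sigma>}) ` T))"
    by simp
  also have "\<dots> face_of ?P"
  proof (rule face_of_Inter)
    fix F assume "F \<in> insert ?P ((\<lambda>\<sigma>. ?P \<inter> {x. (\<chi> i. if i \<in> \<sigma> then 1 else 0) \<bullet> x = polytope_bound E \<sigma>}) ` T)"
    then show "F face_of ?P"
      by (auto simp: face_of_refl convex_graph_polytope
          intro!: face_of_Int_supporting_hyperplane_ge)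
         (auto simp: inner_vec_def if_distrib[of "\<lambda>c. c * _"] sum.If_cases graph_polytope_iff cong: if_cong)
  qed simp
  finally show ?thesis .
qed

lemma sum_level_eq:
  fixes h :: "'n::finite \<Rightarrow> nat" and x y :: "real ^ 'n"
  assumes "\<And>t. (\<Sum>i | h i < t. x $ i) = (\<Sum>i | h i < t. y $ i)"
  shows "(\<Sum>i | h i = t. x $ i) = (\<Sum>i | h i = t. y $ i)"
proof -
  have "(\<Sum>i | h i < Suc t. z $ i) = (\<Sum>i | h i < t. z $ i) + (\<Sum>i | h i = t. z $ i)" for z :: "real ^ 'n"
    by (subst sum.union_disjoint[symmetric]) (auto intro!: sum.cong)
  then show ?thesis using assms[of t] assms[of "Suc t"] by simp
qed

text \<open>Consecutive initial segments of a linear extension differ by at most one vertex, so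
  tightness on all of them fixes every coordinate, and the face of the downsets is a single
  point.\<close>

lemma orientation_point_extreme:
  fixes E :: "'n::finite set set"
  assumes E: "simple_graph UNIV E" and D: "D \<in> acyclic_orientations E"
  shows "orientation_point D extreme_point_of graph_polytope E"
proof -
  have D': "orientation E D" "acyclic D" using D by (auto simp: acyclic_orientations_def)
  obtain g :: "'n \<Rightarrow> nat" where g: "inj g" "\<And>a b. (a, b) \<in> D \<Longrightarrow> g a < g b"
    using acyclic_linear_extension[OF D'(2)] by blast
  let ?F = "{x \<in> graph_polytope E. \<forall>\<sigma>\<in>downsets D. (\<Sum>i\<in>\<sigma>. x $ i) = polytope_bound E \<sigma>}"
  have pF: "orientation_point D \<in> ?F"
    using orientation_point_in_polytope[OF E D'(1)] sum_orientation_point_downset[OF E D'(1)] by simp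
  have down: "{i. g i < t} \<in> downsets D" for t
    using g(2) by (force simp: downsets_def)
  have "x = orientation_point D" if "x \<in> ?F" for x
  proof -
    have "(\<Sum>i | g i < t. x $ i) = (\<Sum>i | g i < t. orientation_point D $ i)" for t
      using that pF down[of t] by simp
    note * = sum_level_eq[where h = g, OF this]
    have "{i. g i = g j} = {j}" for j using g(1) by (auto dest: injD)
    then have "x $ j = orientation_point D $ j" for j using *[of "g j"] by simp
    then show ?thesis by (simp add: vec_eq_iff)
  qed
  then have "?F = {orientation_point D}" using pF by blast
  then show ?thesis
    using tight_face_of_graph_polytope[of E "downsets D"] by (simp add: face_of_singleton)
qed

text \<open>Abel summation: \<open>c\<close> is a constant plus a nonnegative combination of indicators of its
  superlevel sets.\<close>

lemma superlevel_sums_nonneg_imp_sum_nonneg: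
  fixes c y :: "'n::finite \<Rightarrow> real"
  assumes "(\<Sum>i\<in>UNIV. y i) = 0" "\<And>t. (\<Sum>i | c i \<ge> t. y i) \<ge> 0"
  shows "(\<Sum>i\<in>UNIV. c i * y i) \<ge> 0"
  using assms(2)
proof (induction "card (range c)" arbitrary: c rule: less_induct)
  case less
  define M where "M = Max (range c)"
  have M: "c i \<le> M" for i by (simp add: M_def)
  have "M \<in> range c" unfolding M_def by (rule Max_in) auto
  show ?case
  proof (cases "range c - {M} = {}")
    case True
    then have "c i = M" for i by auto
    then show ?thesis using assms(1) by (simp flip: sum_distrib_left)
  next
    case False
    define M' where "M' = Max (range c - {M})"
    have "M' \<in> range c - {M}" unfolding M'_def using False by (intro Max_in) auto
    then have M': "M' \<in> range c" "M' < M" using M by (auto simp: less_le)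
    have leM': "c i \<le> M'" if "c i \<noteq> M" for i unfolding M'_def using that by (intro Max_ge) auto
    \<comment> \<open>Capping at the second largest value removes one value from the range. The part
      cut off is \<open>M - M'\<close> on the top level set, where \<open>y\<close> has nonnegative
      sum.\<close>
    define c' where "c' i = min (c i) M'" for i
    have "range c' \<subseteq> range c - {M}" using M' by (auto simp: c'_def min_def)
    also have "\<dots> \<subset> range c" using \<open>M \<in> range c\<close> by auto
    finally have "card (range c') < card (range c)" by (intro psubset_card_mono) auto
    moreover have "(\<Sum>i | c' i \<ge> t. y i) \<ge> 0" for t
    proof (cases "t \<le> M'")
      case True
      then have "{i. c' i \<ge> t} = {i. c i \<ge> t}" by (auto simp: c'_def)
      then show ?thesis using less.prems by simp
    next
      case False
      then have "{i. c' i \<ge> t} = {}" by (auto simp: c'_def)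
      then show ?thesis by (simp only: sum.empty)
    qed
    ultimately have "(\<Sum>i\<in>UNIV. c' i * y i) \<ge> 0" using less.hyps by blast
    moreover have "c i * y i = c' i * y i + (if c i \<ge> M then (M - M') * y i else 0)" for i
      using M[of i] M' leM'[of i] by (auto simp: c'_def min_def algebra_simps)
    then have "(\<Sum>i\<in>UNIV. c i * y i) = (\<Sum>i\<in>UNIV. c' i * y i) + (M - M') * (\<Sum>i | c i \<ge> M. y i)"
      by (simp add: sum.distrib sum.If_cases sum_distrib_left)
    ultimately show ?thesis using less.prems[of M] M' by simp
  qed
qed

lemma graph_polytope_eq_convex_hull:
  fixes E :: "'n::finite set set"
  assumes E: "simple_graph UNIV E"
  shows "graph_polytope E = convex hull (orientation_point ` acyclic_orientations E)"
proof
  let ?H = "convex hull (orientation_point ` acyclic_orientations E)"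
  show "?H \<subseteq> graph_polytope E"
    using orientation_point_in_polytope[OF E]
    by (intro hull_minimal convex_graph_polytope) (auto simp: acyclic_orientations_def)
  show "graph_polytope E \<subseteq> ?H"
  proof (rule subsetI, rule ccontr)
    fix x assume x: "x \<in> graph_polytope E" and "x \<notin> ?H"
    moreover have "closed ?H"
      by (intro compact_imp_closed compact_convex_hull finite_imp_compact) simp
    ultimately obtain c b where c: "c \<bullet> x < b" "\<And>y. y \<in> ?H \<Longrightarrow> b < c \<bullet> y"
      using separating_hyperplane_closed_point[of ?H x] by (metis convex_convex_hull)
    obtain D where D: "D \<in> acyclic_orientations E" "\<And>u v. (u, v) \<in> D \<Longrightarrow> c $ u \<ge> c $ v"
      using exists_acyclic_orientation_antimono[OF E, of "\<lambda>i. c $ i"] by blast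
    then have oD: "orientation E D" by (simp add: acyclic_orientations_def)
    let ?p = "orientation_point D"
    \<comment> \<open>The superlevel sets of \<open>c\<close> are down-closed in \<open>D\<close>:
      there \<open>?p\<close> is tight while \<open>x\<close> only satisfies the bound, so
      \<open>x - ?p\<close> has nonnegative sums. The result contradicts the separation.\<close>
    have "0 \<le> (\<Sum>i\<in>UNIV. c $ i * (x - ?p) $ i)"
    proof (rule superlevel_sums_nonneg_imp_sum_nonneg)
      have "?p \<in> graph_polytope E" by (rule orientation_point_in_polytope[OF E oD])
      then show "(\<Sum>i\<in>UNIV. (x - ?p) $ i) = 0"
        using x by (simp add: sum_subtractf graph_polytope_iff)
      fix t
      have "{i. c $ i \<ge> t} \<in> downsets D" using D(2) by (force simp: downsets_def)
      from sum_orientation_point_downset[OF E oD this]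
      show "(\<Sum>i | c $ i \<ge> t. (x - ?p) $ i) \<ge> 0"
        using x by (simp add: sum_subtractf graph_polytope_iff)
    qed
    also have "\<dots> = c \<bullet> x - c \<bullet> ?p"
      by (simp add: inner_vec_def right_diff_distrib sum_subtractf)
    finally show False using c(1) c(2)[of ?p] D(1) by (simp add: hull_inc)
  qed
qed

lemma skeleton_vertices_graph_polytope:
  fixes E :: "'n::finite set set"
  assumes E: "simple_graph UNIV E"
  shows "skeleton_vertices (graph_polytope E) = orientation_point ` acyclic_orientations E"
  unfolding skeleton_vertices_def
  using orientation_point_extreme[OF E] extreme_point_of_convex_hull graph_polytope_eq_convex_hull[OF E]
  by fastforce

lemma orientation_point_reverse_edge:
  fixes D :: "('n::finite \<times> 'n) set"
  assumes D: "orientation E D" "(u, v) \<in> D"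
  shows "orientation_point (reverse_edge D (u, v)) = orientation_point D + axis u 1 - axis v 1"
proof -
  have ne: "u \<noteq> v" and vu: "(v, u) \<notin> D"
    using D orientation_irrefl[OF D(1)] orientation_asym[OF D] by auto
  have "{w. (w, u) \<in> reverse_edge D (u, v)} = insert v {w. (w, u) \<in> D}"
    "{w. (w, v) \<in> reverse_edge D (u, v)} = {w. (w, v) \<in> D} - {u}"
    using ne by (auto simp: reverse_edge_def)
  moreover have "{w. (w, i) \<in> reverse_edge D (u, v)} = {w. (w, i) \<in> D}" if "i \<noteq> u" "i \<noteq> v" for i
    using that by (auto simp: reverse_edge_def)
  \<comment> \<open>Makes the natural-number subtraction in the new indegree of \<open>v\<close>
    exact.\<close>
  moreover have "card {w. (w, v) \<in> D} \<ge> 1"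
    using D(2) by (auto simp: Suc_le_eq card_gt_0_iff)
  ultimately show ?thesis
    using D(2) vu ne
    by (auto simp: vec_eq_iff orientation_point_def indeg_def axis_def card_Diff_singleton of_nat_diff)
qed

section \<open>Edges of the polytope\<close>

text \<open>For acyclic orientations \<open>D \<noteq> D'\<close>, reverse some \<open>(a, b) \<in> Cov D\<close> that \<open>D'\<close> orients the
  other way, in both: this preserves the sum of the two points, while the reversal of \<open>D\<close> stays
  acyclic.\<close>

lemma Cov_exchange:
  fixes D D' :: "('n::finite \<times> 'n) set"
  assumes E: "simple_graph UNIV E"
    and D: "D \<in> acyclic_orientations E" "D' \<in> acyclic_orientations E" "D \<noteq> D'"
  obtains a b z where "(a, b) \<in> Cov D" "z \<in> graph_polytope E"
    "orientation_point D + orientation_point D' = orientation_point (reverse_edge D (a, b)) + z"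
proof -
  have o: "orientation E D" "orientation E D'" using D by (auto simp: acyclic_orientations_def)
  obtain a b where ab: "(a, b) \<in> Cov D" "(b, a) \<in> D'" by (rule exists_Cov_reversed[OF D])
  then have "(a, b) \<in> D" using Cov_subset by auto
  show thesis
  proof (rule that[OF ab(1), of "orientation_point (reverse_edge D' (b, a))"])
    show "orientation_point (reverse_edge D' (b, a)) \<in> graph_polytope E"
      by (intro orientation_point_in_polytope[OF E] orientation_reverse_edge o ab)
  qed (simp add: orientation_point_reverse_edge[OF o(1) \<open>(a, b) \<in> D\<close>]
      orientation_point_reverse_edge[OF o(2) ab(2)])
qed

lemma orientation_point_reverse_edge_neq:
  fixes D :: "('n::finite \<times> 'n) set"
  assumes D: "orientation E D" "(u, v) \<in> D"
  shows "orientation_point (reverse_edge D (u, v)) \<noteq> orientation_point D"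
proof
  assume "orientation_point (reverse_edge D (u, v)) = orientation_point D"
  then have "axis u 1 - axis v (1::real) = 0"
    using orientation_point_reverse_edge[OF assms] by simp
  then have "(axis u 1 - axis v (1::real)) $ u = 0" by simp
  then show False using orientation_irrefl[OF D(1)] D(2) by (auto simp: axis_def split: if_splits)
qed

text \<open>The common midpoint lies in \<open>F\<close> by convexity, and a face that meets the
  open segment between two points of \<open>P\<close> contains both. If \<open>y = z\<close> that
  segment is empty, but then the midpoint is \<open>y\<close> itself.\<close>

lemma midpoint_in_face:
  assumes "F face_of P" "p \<in> F" "q \<in> F" "y \<in> P" "z \<in> P" "p + q = y + z"
  shows "y \<in> F"
proof -
  have "midpoint p q \<in> F"
    using assms(1-3) by (meson convex_contains_segment face_of_imp_convex midpoint_in_closed_segment subsetD)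
  then have mF: "midpoint y z \<in> F" using assms(6) by (simp add: midpoint_def)
  show ?thesis
  proof (cases "y = z")
    case False
    then have "midpoint y z \<in> open_segment y z" by simp
    then show ?thesis using assms(1,4,5) mF unfolding face_of_def by blast
  qed (use mF in simp)
qed

text \<open>If two orientations shared a point, the exchange would place the point of a reversal in
  the face consisting of that vertex alone, although a reversal always moves the point.\<close>

lemma inj_on_orientation_point:
  fixes E :: "'n::finite set set"
  assumes E: "simple_graph UNIV E"
  shows "inj_on orientation_point (acyclic_orientations E)"
proof (rule inj_onI, rule ccontr)
  fix D D' assume D: "D \<in> acyclic_orientations E" "D' \<in> acyclic_orientations E" "D \<noteq> D'"
    and eq: "orientation_point D = orientation_point D'"
  obtain a b z where ab: "(a, b) \<in> Cov D" "z \<in> graph_polytope E"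
    "orientation_point D + orientation_point D' = orientation_point (reverse_edge D (a, b)) + z"
    by (rule Cov_exchange[OF E D])
  have D1: "reverse_edge D (a, b) \<in> acyclic_orientations E"
    by (rule acyclic_orientations_reverse_Cov[OF D(1) ab(1)])
  have "{orientation_point D} face_of graph_polytope E"
    using orientation_point_extreme[OF E D(1)] by (simp add: face_of_singleton)
  from midpoint_in_face[OF this, of "orientation_point D" "orientation_point D'"] ab(2,3) eq
  have "orientation_point (reverse_edge D (a, b)) = orientation_point D"
    using orientation_point_in_polytope[OF E] D1 by (auto simp: acyclic_orientations_def)
  then show False
    using orientation_point_reverse_edge_neq[of E D a b] D(1) ab(1) Cov_subset
    by (auto simp: acyclic_orientations_def)
qed

lemma aff_dim_closed_segment: "aff_dim (closed_segment x y) = (if x = y then 0 else 1)"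
  by (simp add: segment_convex_hull aff_dim_convex_hull aff_dim_2)

text \<open>On the face, the levels of the contraction fix all coordinates except those of
  \<open>u\<close> and \<open>v\<close>, and fix the sum of these two. Only one degree of freedom
  remains.\<close>

lemma Cov_segment_edge:
  fixes D :: "('n::finite \<times> 'n) set"
  assumes E: "simple_graph UNIV E" and D: "D \<in> acyclic_orientations E" and uv: "(u, v) \<in> Cov D"
  shows "closed_segment (orientation_point D) (orientation_point (reverse_edge D (u, v)))
    edge_of graph_polytope E"
proof -
  let ?D' = "reverse_edge D (u, v)"
  let ?p = "orientation_point D" and ?p' = "orientation_point ?D'"
  have D': "orientation E D" "acyclic D" using D by (auto simp: acyclic_orientations_def)
  have uvD: "(u, v) \<in> D" using uv Cov_subset by auto
  have o': "orientation E ?D'" by (rule orientation_reverse_edge[OF D'(1) uvD])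
  have p': "?p' = ?p + axis u 1 - axis v 1" by (rule orientation_point_reverse_edge[OF D'(1) uvD])
  have ne: "u \<noteq> v" and vu: "(v, u) \<notin> D" and irr: "\<And>a. (a, a) \<notin> D"
    using uvD orientation_irrefl[OF D'(1)] orientation_asym[OF D'(1) uvD] by auto
  obtain h :: "'n \<Rightarrow> nat" where h: "\<And>a b. (a, b) \<in> D \<Longrightarrow> h a \<le> h b"
    "\<And>a b. h a = h b \<longleftrightarrow> a = b \<or> {a, b} = {u, v}"
    using Cov_contraction[OF D'(2) uv] by blast
  have huv: "h v = h u" using h(2) by blast
  have strict: "h a < h b" if "(a, b) \<in> D" "(a, b) \<noteq> (u, v)" for a b
  proof -
    have "h a \<noteq> h b" using h(2)[of a b] that irr vu by (auto simp: doubleton_eq_iff)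
    then show ?thesis using h(1)[OF that(1)] by simp
  qed
  have down: "{i. h i < t} \<in> downsets D \<inter> downsets ?D'" for t
    using h(1) huv by (force simp: downsets_def reverse_edge_def)
  \<comment> \<open>This set and the next are each down-closed for only one of the two orientations.
    They need not be tight on the face; their inequalities bound \<open>x $ u\<close> and
    \<open>x $ v\<close> from below and so mark the two ends of the segment.\<close>
  have downu: "insert u {i. h i < h u} \<in> downsets D"
    using strict huv ne by (force simp: downsets_def)
  have downv: "insert v {i. h i < h u} \<in> downsets ?D'"
    using strict huv ne by (force simp: downsets_def reverse_edge_def)
  let ?F = "{x \<in> graph_polytope E. \<forall>\<sigma>\<in>downsets D \<inter> downsets ?D'. (\<Sum>i\<in>\<sigma>. x $ i) = polytope_bound E \<sigma>}"
  have face: "?F face_of graph_polytope E" by (rule tight_face_of_graph_polytope)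
  have pF: "?p \<in> ?F" "?p' \<in> ?F"
    using orientation_point_in_polytope[OF E D'(1)] sum_orientation_point_downset[OF E D'(1)]
      orientation_point_in_polytope[OF E o'] sum_orientation_point_downset[OF E o'] by simp_all
  have "?F = closed_segment ?p ?p'"
  proof
    show "closed_segment ?p ?p' \<subseteq> ?F"
      by (rule closed_segment_subset[OF pF face_of_imp_convex[OF face]])
    show "?F \<subseteq> closed_segment ?p ?p'"
    proof
      fix x assume x: "x \<in> ?F"
      then have xP: "x \<in> graph_polytope E" by simp
      have eq: "(\<Sum>i | h i < t. x $ i) = (\<Sum>i | h i < t. ?p $ i)" for t
        using x pF down[of t] by simp
      have eq': "(\<Sum>i | h i < t. x $ i) = (\<Sum>i | h i < t. ?p' $ i)" for t
        using x pF down[of t] by simp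
      note level = sum_level_eq[where h = h, OF eq]
      have other: "x $ j = ?p $ j" if "j \<noteq> u" "j \<noteq> v" for j
      proof -
        have "{i. h i = h j} = {j}" using that h(2)[of _ j] by (auto simp: doubleton_eq_iff)
        then show ?thesis using level[of "h j"] by simp
      qed
      have "{i. h i = h u} = {u, v}" using h(2)[of _ u] by (auto simp: doubleton_eq_iff)
      then have pair: "x $ u + x $ v = ?p $ u + ?p $ v" using level[of "h u"] ne by simp
      have "(\<Sum>i\<in>insert u {i. h i < h u}. x $ i) \<ge> (\<Sum>i\<in>insert u {i. h i < h u}. ?p $ i)"
        using xP sum_orientation_point_downset[OF E D'(1) downu] by (simp add: graph_polytope_iff del: sum.insert)
      then have lu: "x $ u \<ge> ?p $ u" using eq[of "h u"] by simp
      have "(\<Sum>i\<in>insert v {i. h i < h u}. x $ i) \<ge> (\<Sum>i\<in>insert v {i. h i < h u}. ?p' $ i)"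
        using xP sum_orientation_point_downset[OF E o' downv] by (simp add: graph_polytope_iff del: sum.insert)
      then have lv: "x $ v \<ge> ?p' $ v" using eq'[of "h u"] huv by simp
      \<comment> \<open>The coordinate of \<open>u\<close> grows by exactly 1 from \<open>?p\<close>
        to \<open>?p'\<close>, so this difference is the parameter of \<open>x\<close> along the
        segment.\<close>
      define s where "s = x $ u - ?p $ u"
      have s: "0 \<le> s" "s \<le> 1"
        using lu lv pair ne by (simp_all add: s_def p' axis_def)
      have "x = (1 - s) *\<^sub>R ?p + s *\<^sub>R ?p'"
        using other pair ne by (auto simp: vec_eq_iff p' axis_def s_def algebra_simps)
      then show "x \<in> closed_segment ?p ?p'" using s by (auto simp: closed_segment_def)
    qed
  qed
  then show ?thesis
    using face orientation_point_reverse_edge_neq[OF D'(1) uvD]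
    by (simp add: edge_of_def aff_dim_closed_segment)
qed

lemma edge_imp_reverse_Cov:
  fixes D D' :: "('n::finite \<times> 'n) set"
  assumes E: "simple_graph UNIV E"
    and D: "D \<in> acyclic_orientations E" "D' \<in> acyclic_orientations E"
    and edge: "closed_segment (orientation_point D) (orientation_point D') edge_of graph_polytope E"
  shows "D' \<in> reverse_edge D ` Cov D"
proof -
  let ?p = "orientation_point D" and ?p' = "orientation_point D'"
  have face: "closed_segment ?p ?p' face_of graph_polytope E" and "?p \<noteq> ?p'"
    using edge by (auto simp: edge_of_def aff_dim_closed_segment split: if_splits)
  then have "D \<noteq> D'" by auto
  obtain a b z where ab: "(a, b) \<in> Cov D" "z \<in> graph_polytope E"
    "?p + ?p' = orientation_point (reverse_edge D (a, b)) + z"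
    by (rule Cov_exchange[OF E D \<open>D \<noteq> D'\<close>])
  let ?q = "orientation_point (reverse_edge D (a, b))"
  have D1: "reverse_edge D (a, b) \<in> acyclic_orientations E"
    by (rule acyclic_orientations_reverse_Cov[OF D(1) ab(1)])
  then have "?q \<in> graph_polytope E"
    using orientation_point_in_polytope[OF E] by (auto simp: acyclic_orientations_def)
  then have "?q \<in> closed_segment ?p ?p'"
    by (intro midpoint_in_face[OF face _ _ _ ab(2,3)]) auto
  \<comment> \<open>A vertex of the polytope that lies in a face is extreme in it, and a segment has
    only its ends as extreme points.\<close>
  then have "?q extreme_point_of closed_segment ?p ?p'"
    using extreme_point_of_face[OF face] orientation_point_extreme[OF E D1] by simp
  then have "?q = ?p \<or> ?q = ?p'" by (simp add: extreme_point_of_segment)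
  moreover have "?q \<noteq> ?p"
    using orientation_point_reverse_edge_neq[of E D a b] D(1) ab(1) Cov_subset
    by (auto simp: acyclic_orientations_def)
  ultimately have "reverse_edge D (a, b) = D'"
    using inj_on_orientation_point[OF E] D1 D(2) by (auto dest: inj_onD)
  then show ?thesis using ab(1) by blast
qed

section \<open>The 1-skeleton as a graph on acyclic orientations\<close>

lemma orientation_skeleton_edges_iff:
  fixes E :: "'n::finite set set"
  assumes E: "simple_graph UNIV E"
  shows "{D, D'} \<in> orientation_skeleton_edges E \<longleftrightarrow>
    D \<in> acyclic_orientations E \<and> D' \<in> reverse_edge D ` Cov D" (is "?l \<longleftrightarrow> ?r")
proof
  assume ?l
  then have D: "D \<in> acyclic_orientations E" "D' \<in> acyclic_orientations E"
    and "{orientation_point D, orientation_point D'} \<in> skeleton_edges (graph_polytope E)"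
    by (auto simp: orientation_skeleton_edges_def doubleton_eq_iff insert_commute)
  then have "closed_segment (orientation_point D) (orientation_point D') edge_of graph_polytope E"
    by (auto simp: skeleton_edges_def doubleton_eq_iff closed_segment_commute)
  then show ?r using edge_imp_reverse_Cov[OF E D] D by blast
next
  assume r: ?r
  then obtain u v where uv: "(u, v) \<in> Cov D" "D' = reverse_edge D (u, v)" by auto
  then have D: "D \<in> acyclic_orientations E" "D' \<in> acyclic_orientations E"
    using r acyclic_orientations_reverse_Cov by auto
  then have "{orientation_point D, orientation_point D'} \<in> skeleton_edges (graph_polytope E)"
    unfolding skeleton_edges_def
    using Cov_segment_edge[OF E D(1) uv(1)] orientation_point_extreme[OF E] uv(2) by blast
  then show ?l using D unfolding orientation_skeleton_edges_def by blast
qed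

lemma simple_graph_orientation_skeleton:
  fixes E :: "'n::finite set set"
  assumes E: "simple_graph UNIV E"
  shows "simple_graph (acyclic_orientations E) (orientation_skeleton_edges E)"
  unfolding simple_graph_def
proof
  fix e assume e: "e \<in> orientation_skeleton_edges E"
  then obtain D D' where D: "e = {D, D'}" "D \<in> acyclic_orientations E" "D' \<in> acyclic_orientations E"
    by (auto simp: orientation_skeleton_edges_def)
  then have "D' \<in> reverse_edge D ` Cov D" using e orientation_skeleton_edges_iff[OF E] by simp
  then have "D \<noteq> D'"
    using D(2) Cov_subset orientation_point_reverse_edge_neq[of E D]
    by (fastforce simp: acyclic_orientations_def)
  then show "\<exists>u\<in>acyclic_orientations E. \<exists>v\<in>acyclic_orientations E. u \<noteq> v \<and> e = {u, v}"
    using D by blast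
qed

lemma connected_graph_orientation_skeleton:
  fixes E :: "'n::finite set set"
  assumes E: "simple_graph UNIV E"
  shows "connected_graph (acyclic_orientations E) (orientation_skeleton_edges E)"
proof -
  let ?r = "{(x, y). {x, y} \<in> orientation_skeleton_edges E}"
  have "(D, D') \<in> ?r\<^sup>*" if "D \<in> acyclic_orientations E" and D': "D' \<in> acyclic_orientations E" for D D'
    using that(1)
  \<comment> \<open>The measure counts the edges on which \<open>D\<close> disagrees with
    \<open>D'\<close>; reversing a cover relation of \<open>D\<close> that \<open>D'\<close> orients
    oppositely removes one disagreement.\<close>
  proof (induction "card (D - D')" arbitrary: D rule: less_induct)
    case less
    show ?case
    proof (cases "D = D'")
      case False
      obtain a b where ab: "(a, b) \<in> Cov D" "(b, a) \<in> D'"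
        by (rule exists_Cov_reversed[OF less.prems D' False])
      let ?D1 = "reverse_edge D (a, b)"
      have "(a, b) \<in> D" "(a, b) \<notin> D'"
        using ab Cov_subset D' orientation_asym[of E D' b a] by (auto simp: acyclic_orientations_def)
      then have "?D1 - D' \<subset> D - D'" using ab(2) by (auto simp: reverse_edge_def)
      then have "card (?D1 - D') < card (D - D')" by (intro psubset_card_mono) auto
      then have "(?D1, D') \<in> ?r\<^sup>*"
        using acyclic_orientations_reverse_Cov[OF less.prems ab(1)] by (rule less.hyps)
      moreover have "(D, ?D1) \<in> ?r"
        using orientation_skeleton_edges_iff[OF E] less.prems ab(1) by auto
      ultimately show ?thesis by (rule converse_rtrancl_into_rtrancl[rotated])
    qed simp
  qed
  moreover have "acyclic_orientations E \<noteq> {}"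
    using exists_acyclic_orientation_antimono[OF E, of "\<lambda>_. 0"] by blast
  ultimately show ?thesis by (simp add: connected_graph_def)
qed

lemma bipartite_graph_orientation_skeleton:
  fixes E :: "'n::finite set set"
  assumes E: "simple_graph UNIV E"
  shows "bipartite_graph (acyclic_orientations E) (orientation_skeleton_edges E)"
proof -
  obtain R where "R \<in> acyclic_orientations E"
    using exists_acyclic_orientation_antimono[OF E, of "\<lambda>_. 0"] by blast
  then have R: "orientation E R" by (simp add: acyclic_orientations_def)
  \<comment> \<open>\<open>D \<inter> R\<close> collects the edges on which \<open>D\<close> agrees
    with the reference \<open>R\<close>; one reversal adds or removes exactly one of them.\<close>
  let ?A = "{D \<in> acyclic_orientations E. even (card (D \<inter> R))}"
  let ?B = "{D \<in> acyclic_orientations E. odd (card (D \<inter> R))}"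
  have "\<exists>a\<in>?A. \<exists>b\<in>?B. e = {a, b}" if e: "e \<in> orientation_skeleton_edges E" for e
  proof -
    obtain D D' where D: "e = {D, D'}" "D \<in> acyclic_orientations E" "D' \<in> acyclic_orientations E"
      using e by (auto simp: orientation_skeleton_edges_def)
    then obtain u v where uv: "(u, v) \<in> Cov D" "D' = reverse_edge D (u, v)"
      using e orientation_skeleton_edges_iff[OF E] by auto
    have o: "orientation E D" using D by (simp add: acyclic_orientations_def)
    have uvD: "(u, v) \<in> D" using uv Cov_subset by auto
    have vu: "(v, u) \<notin> D" by (rule orientation_asym[OF o uvD])
    have "even (card (D' \<inter> R)) \<longleftrightarrow> odd (card (D \<inter> R))"
    proof (cases "(u, v) \<in> R")
      case True
      then have "D \<inter> R = insert (u, v) (D' \<inter> R)" "(u, v) \<notin> D' \<inter> R"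
        using uvD vu orientation_asym[OF R True] by (auto simp: uv(2) reverse_edge_def)
      then show ?thesis by simp
    next
      case False
      then have "(v, u) \<in> R"
        using orientation_total[OF R orientation_edge[OF o uvD]] by simp
      then have "D' \<inter> R = insert (v, u) (D \<inter> R)" "(v, u) \<notin> D \<inter> R"
        using vu False by (auto simp: uv(2) reverse_edge_def)
      then show ?thesis by simp
    qed
    then show ?thesis
      using D by (cases "even (card (D \<inter> R))") (auto simp: insert_commute)
  qed
  then show ?thesis
    unfolding bipartite_graph_def by (intro exI[of _ ?A] exI[of _ ?B]) auto
qed

section \<open>The Cover-Reversal walk\<close>

lemma neighbours_orientation_skeleton:
  fixes E :: "'n::finite set set"
  assumes "simple_graph UNIV E" "D \<in> acyclic_orientations E"
  shows "neighbours (orientation_skeleton_edges E) D = reverse_edge D ` Cov D"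
  using assms by (auto simp: neighbours_def orientation_skeleton_edges_iff)

lemma inj_on_reverse_edge_Cov:
  assumes "D \<in> acyclic_orientations E"
  shows "inj_on (reverse_edge D) (Cov D)"
  using assms inj_on_reverse_edge[of E D] Cov_subset[of D]
  by (auto simp: acyclic_orientations_def intro: inj_on_subset)

text \<open>Reversal is injective on cover relations, so it carries the uniform distribution on
  \<open>Cov D\<close> to the uniform one on the neighbours. Some edge is needed for
  \<open>Cov D\<close> to be nonempty: otherwise \<open>pmf_of_set\<close> is unspecified.\<close>

lemma simple_random_walk_cover_reversal:
  fixes E :: "'n::finite set set"
  assumes E: "simple_graph UNIV E" "E \<noteq> {}"
  shows "simple_random_walk (acyclic_orientations E) (orientation_skeleton_edges E) cover_reversal"
  unfolding simple_random_walk_def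
proof
  fix D assume D: "D \<in> acyclic_orientations E"
  then have o: "orientation E D" "acyclic D" by (auto simp: acyclic_orientations_def)
  obtain e where "e \<in> E" using E(2) by auto
  then obtain u v where "{u, v} \<in> E" using E(1) unfolding simple_graph_def by metis
  then have "D \<noteq> {}" using orientation_total[OF o(1)] by blast
  then have Cov: "Cov D \<noteq> {}" using trancl_Cov[OF o(2)] by auto
  then show "neighbours (orientation_skeleton_edges E) D \<noteq> {} \<and>
      finite (neighbours (orientation_skeleton_edges E) D) \<and>
      cover_reversal D = pmf_of_set (neighbours (orientation_skeleton_edges E) D)"
    unfolding neighbours_orientation_skeleton[OF E(1) D] cover_reversal_def
    using map_pmf_of_set_inj[OF inj_on_reverse_edge_Cov[OF D] Cov] by simp
qed

theorem theorem5p10: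
  fixes E :: "'n::finite set set"
  assumes "simple_graph UNIV E"
  shows "polytope (graph_polytope E) \<and>
    bij_betw orientation_point (acyclic_orientations E) (skeleton_vertices (graph_polytope E)) \<and>
    simple_graph (acyclic_orientations E) (orientation_skeleton_edges E) \<and>
    connected_graph (acyclic_orientations E) (orientation_skeleton_edges E) \<and>
    bipartite_graph (acyclic_orientations E) (orientation_skeleton_edges E) \<and>
    (E \<noteq> {} \<longrightarrow>
      simple_random_walk (acyclic_orientations E) (orientation_skeleton_edges E) cover_reversal \<and>
      (\<forall>D\<in>acyclic_orientations E. period cover_reversal D = 2) \<and>
      (\<exists>\<pi>. stationary (acyclic_orientations E) cover_reversal \<pi> \<and>
           (\<forall>\<pi>'. stationary (acyclic_orientations E) cover_reversal \<pi>' \<longrightarrow> \<pi>' = \<pi>) \<and>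
           (\<exists>c>0. \<forall>D\<in>acyclic_orientations E. pmf \<pi> D = c * real (card (Cov D)))))"
proof (intro conjI impI)
  note simple = simple_graph_orientation_skeleton[OF assms]
    and conn = connected_graph_orientation_skeleton[OF assms]
    and bip = bipartite_graph_orientation_skeleton[OF assms]
  show "polytope (graph_polytope E)"
    unfolding polytope_def using graph_polytope_eq_convex_hull[OF assms]
    by (intro exI[of _ "orientation_point ` acyclic_orientations E"]) simp
  show "bij_betw orientation_point (acyclic_orientations E) (skeleton_vertices (graph_polytope E))"
    unfolding skeleton_vertices_graph_polytope[OF assms]
    by (rule inj_on_imp_bij_betw[OF inj_on_orientation_point[OF assms]])
  show "simple_graph (acyclic_orientations E) (orientation_skeleton_edges E)" by (fact simple)
  show "connected_graph (acyclic_orientations E) (orientation_skeleton_edges E)" by (fact conn)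
  show "bipartite_graph (acyclic_orientations E) (orientation_skeleton_edges E)" by (fact bip)
  assume "E \<noteq> {}"
  then show walk: "simple_random_walk (acyclic_orientations E) (orientation_skeleton_edges E) cover_reversal"
    by (rule simple_random_walk_cover_reversal[OF assms])
  show "\<forall>D\<in>acyclic_orientations E. period cover_reversal D = 2"
    using period_bipartite_simple_random_walk[OF simple bip walk] by blast
  obtain \<pi> c where \<pi>: "stationary (acyclic_orientations E) cover_reversal \<pi>" "c > 0"
    "\<And>D. D \<in> acyclic_orientations E \<Longrightarrow>
      pmf \<pi> D = c * real (card (neighbours (orientation_skeleton_edges E) D))"
    "\<And>\<pi>'. stationary (acyclic_orientations E) cover_reversal \<pi>' \<Longrightarrow> \<pi>' = \<pi>"
    by (rule stationary_simple_random_walk[OF finite simple conn walk]) (rule that)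
  \<comment> \<open>Distinct cover relations lead to distinct neighbours, so the degree of
    \<open>D\<close> is the size of \<open>Cov D\<close>.\<close>
  have Cov: "pmf \<pi> D = c * real (card (Cov D))" if "D \<in> acyclic_orientations E" for D
    using \<pi>(3)[OF that] inj_on_reverse_edge_Cov[OF that]
    by (simp add: neighbours_orientation_skeleton[OF assms that] card_image)
  show "\<exists>\<pi>. stationary (acyclic_orientations E) cover_reversal \<pi> \<and>
      (\<forall>\<pi>'. stationary (acyclic_orientations E) cover_reversal \<pi>' \<longrightarrow> \<pi>' = \<pi>) \<and>
      (\<exists>c>0. \<forall>D\<in>acyclic_orientations E. pmf \<pi> D = c * real (card (Cov D)))"
    by (intro exI[of _ \<pi>] conjI allI impI exI[of _ c] ballI \<pi>(1,2,4) Cov)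
qed

end
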